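(* Under the standing assumptions listed in the context, suppose that one of the following conditions holds. (1) For $i=1,2$: $f_i(t,u_1,u_2)<m_i|u_i|$ for every $t\in[0,1]$ and all $(u_1,u_2)\in\mathbb R^2$ with $u_i\ne0$. (2) For $i=1,2$: $f_i(t,u_1,u_2)>M_iu_i$ for every $t\in[a_i,b_i]$ and all $(u_1,u_2)\in\mathbb R^2$ with $u_i>0$. (3) There exists $i\in\{1,2\}$ such that $f_i(t,u_1,u_2)<m_i|u_i|$ for every $t\in[0,1]$ and all $(u_1,u_2)\in\mathbb R^2$ with $u_i\neq 0$, and, for $j\ne i$, $f_j(t,u_1,u_2)>M_ju_j$ for every $t\in[a_j,b_j]$ and all $(u_1,u_2)\in\mathbb R^2$ with $u_j>0$. Then there is no nontrivial solution in $K$ of the system $$u(t)=\int_0^1 k_1(t,s)g_1(s)f_1(s,u(s),v(s))\,ds,\qquad v(t)=\int_0^1 k_2(t,s)g_2(s)f_2(s,u(s),v(s))\,ds,\qquad t\in[0,1].$$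
   Context: Standing assumptions, for $i=1,2$: - $f_i:[0,1]\times\mathbb R\times\mathbb R\to[0,\infty)$ satisfies Carathéodory conditions: $f_i(\cdot,u,v)$ is measurable for each $(u,v)$, $f_i(t,\cdot,\cdot)$ is continuous for a.e. $t$, and for each $r>0$ there is $\phi_{i,r}\in L^\infty[0,1]$ with $f_i(t,u,v)\le\phi_{i,r}(t)$ for $u,v\in[-r,r]$ and a.e. $t\in[0,1]$. - $k_i:[0,1]\times[0,1]\to\mathbb R$ is measurable, and for every $\tau\in[0,1]$, $\lim_{t\to\tau}|k_i(t,s)-k_i(\tau,s)|=0$ for a.e. $s\in[0,1]$. - There exist a subinterval $[a_i,b_i]\subseteq[0,1]$, $\Phi_i\in L^\infty[0,1]$ and $c_i\in(0,1]$ with $|k_i(t,s)|\le\Phi_i(s)$ for $t\in[0,1]$ and a.e. $s\in[0,1]$, and $k_i(t,s)\ge c_i\Phi_i(s)$ for $t\in[a_i,b_i]$ and a.e. $s\in[0,1]$. - $g_i$ is measurable, $g_i\Phi_i\in L^1[0,1]$, $g_i\ge0$ a.e., and $\int_{a_i}^{b_i}\Phi_i(s)g_i(s)\,ds>0$. $C[0,1]\times C[0,1]$ has the norm $\|(u,v)\|=\max\{\|u\|_\infty,\|v\|_\infty\}$. Let $\tilde K_i=\{w\in C[0,1]:\min_{t\in[a_i,b_i]}w(t)\ge c_i\|w\|_\infty\}$ and $K=\tilde K_1\times\tilde K_2$. A nontrivial solution of the system is a solution $(u,v)\in K$ with $\|(u,v)\|\ne0$. Constants: $\frac1{m_i}=\sup_{t\in[0,1]}\int_0^1|k_i(t,s)|g_i(s)\,ds$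 and $\frac1{M_i}=\inf_{t\in[a_i,b_i]}\int_{a_i}^{b_i}k_i(t,s)g_i(s)\,ds$. *)

theory Defs
  imports "HOL-Analysis.Analysis"
begin

text \<open>
  Functions on \<open>[0,1]\<close> are represented by functions on the reals of which only the values on
  \<open>{0..1}\<close> matter. The index \<open>i = 1, 2\<close> ranges over the type \<^typ>\<open>2\<close>, and
  \<open>(u\<^sub>1, u\<^sub>2)\<close> is a vector \<open>x :: real ^ 2\<close>, so that \<open>u\<^sub>i\<close> is \<open>x $ i\<close>.
  "Measurable" means Lebesgue measurable.
\<close>

abbreviation I01 :: "real measure" where
  "I01 \<equiv> lebesgue_on {0..1}"

definition L_infty :: "(real \<Rightarrow> real) \<Rightarrow> bool" where
  "L_infty \<phi> \<longleftrightarrow> \<phi> \<in> borel_measurable I01 \<and> (\<exists>C. AE t in I01. \<bar>\<phi> t\<bar> \<le> C)"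

definition caratheodory :: "(real \<Rightarrow> real ^ 2 \<Rightarrow> real) \<Rightarrow> bool" where
  "caratheodory f \<longleftrightarrow>
     (\<forall>x. (\<lambda>t. f t x) \<in> borel_measurable I01) \<and>
     (AE t in I01. continuous_on UNIV (f t)) \<and>
     (\<forall>r>0. \<exists>\<phi>. L_infty \<phi> \<and>
        (\<forall>x. x $ 1 \<in> {-r..r} \<and> x $ 2 \<in> {-r..r} \<longrightarrow> (AE t in I01. f t x \<le> \<phi> t)))"

definition nonlinearity :: "(real \<Rightarrow> real ^ 2 \<Rightarrow> real) \<Rightarrow> bool" where
  "nonlinearity f \<longleftrightarrow> (\<forall>t\<in>{0..1}. \<forall>x. 0 \<le> f t x) \<and> caratheodory f"

definition kernel_regular :: "(real \<Rightarrow> real \<Rightarrow> real) \<Rightarrow> bool" where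
  "kernel_regular k \<longleftrightarrow>
     (\<lambda>(t, s). k t s) \<in> borel_measurable (lebesgue_on ({0..1} \<times> {0..1})) \<and>
     (\<forall>\<tau>\<in>{0..1}. AE s in I01. ((\<lambda>t. \<bar>k t s - k \<tau> s\<bar>) \<longlongrightarrow> 0) (at \<tau> within {0..1}))"

definition kernel_bounds ::
  "(real \<Rightarrow> real \<Rightarrow> real) \<Rightarrow> real \<Rightarrow> real \<Rightarrow> (real \<Rightarrow> real) \<Rightarrow> real \<Rightarrow> bool" where
  "kernel_bounds k a b \<Phi> c \<longleftrightarrow>
     0 \<le> a \<and> a \<le> b \<and> b \<le> 1 \<and> L_infty \<Phi> \<and> 0 < c \<and> c \<le> 1 \<and>
     (\<forall>t\<in>{0..1}. AE s in I01. \<bar>k t s\<bar> \<le> \<Phi> s) \<and>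
     (\<forall>t\<in>{a..b}. AE s in I01. c * \<Phi> s \<le> k t s)"

definition weight :: "(real \<Rightarrow> real) \<Rightarrow> (real \<Rightarrow> real) \<Rightarrow> real \<Rightarrow> real \<Rightarrow> bool" where
  "weight g \<Phi> a b \<longleftrightarrow>
     g \<in> borel_measurable I01 \<and>
     integrable I01 (\<lambda>s. g s * \<Phi> s) \<and>
     (AE s in I01. 0 \<le> g s) \<and>
     0 < (LINT s|lebesgue_on {a..b}. \<Phi> s * g s)"

definition sup_norm :: "(real \<Rightarrow> real) \<Rightarrow> real" where
  "sup_norm w = (SUP t\<in>{0..1}. \<bar>w t\<bar>)"

definition pair_norm :: "(real \<Rightarrow> real) \<times> (real \<Rightarrow> real) \<Rightarrow> real" where
  "pair_norm = (\<lambda>(u, v). max (sup_norm u) (sup_norm v))"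

text \<open>The minimum over the compact interval is written as an infimum.\<close>

definition cone_tilde :: "real \<Rightarrow> real \<Rightarrow> real \<Rightarrow> (real \<Rightarrow> real) set" where
  "cone_tilde a b c =
     {w. continuous_on {0..1} w \<and> (INF t\<in>{a..b}. w t) \<ge> c * sup_norm w}"

definition cone ::
  "(2 \<Rightarrow> real) \<Rightarrow> (2 \<Rightarrow> real) \<Rightarrow> (2 \<Rightarrow> real) \<Rightarrow> ((real \<Rightarrow> real) \<times> (real \<Rightarrow> real)) set" where
  "cone a b c = cone_tilde (a 1) (b 1) (c 1) \<times> cone_tilde (a 2) (b 2) (c 2)"

text \<open>
  The constants \<open>m\<^sub>i\<close> and \<open>M\<^sub>i\<close>. Under the standing assumptions the supremum and
  infimum below are finite and positive.
\<close>

definition m_const :: "(real \<Rightarrow> real \<Rightarrow> real) \<Rightarrow> (real \<Rightarrow> real) \<Rightarrow> real" where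
  "m_const k g = 1 / (SUP t\<in>{0..1}. LINT s|I01. \<bar>k t s\<bar> * g s)"

definition M_const ::
  "(real \<Rightarrow> real \<Rightarrow> real) \<Rightarrow> (real \<Rightarrow> real) \<Rightarrow> real \<Rightarrow> real \<Rightarrow> real" where
  "M_const k g a b = 1 / (INF t\<in>{a..b}. LINT s|lebesgue_on {a..b}. k t s * g s)"

text \<open>
  For continuous \<open>u\<close>, \<open>v\<close> the standing assumptions make both integrands integrable, so the
  integrals never take the default value 0 of a non-integrable function.
\<close>

definition solves_system ::
  "(2 \<Rightarrow> real \<Rightarrow> real \<Rightarrow> real) \<Rightarrow> (2 \<Rightarrow> real \<Rightarrow> real) \<Rightarrow> (2 \<Rightarrow> real \<Rightarrow> real ^ 2 \<Rightarrow> real)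
    \<Rightarrow> (real \<Rightarrow> real) \<times> (real \<Rightarrow> real) \<Rightarrow> bool" where
  "solves_system k g f = (\<lambda>(u, v). \<forall>t\<in>{0..1}.
     u t = (LINT s|I01. k 1 t s * g 1 s * f 1 s (vector [u s, v s])) \<and>
     v t = (LINT s|I01. k 2 t s * g 2 s * f 2 s (vector [u s, v s])))"

definition nontrivial_solution ::
  "(2 \<Rightarrow> real \<Rightarrow> real \<Rightarrow> real) \<Rightarrow> (2 \<Rightarrow> real \<Rightarrow> real) \<Rightarrow> (2 \<Rightarrow> real \<Rightarrow> real ^ 2 \<Rightarrow> real)
    \<Rightarrow> (2 \<Rightarrow> real) \<Rightarrow> (2 \<Rightarrow> real) \<Rightarrow> (2 \<Rightarrow> real)
    \<Rightarrow> (real \<Rightarrow> real) \<times> (real \<Rightarrow> real) \<Rightarrow> bool" where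
  "nontrivial_solution k g f a b c w \<longleftrightarrow>
     w \<in> cone a b c \<and> solves_system k g f w \<and> pair_norm w \<noteq> 0"

end

theory Submission
  imports Defs
begin

text \<open>
  The two components of the system decouple: each of the two one-sided growth conditions, imposed
  on the \<open>i\<close>-th nonlinearity alone, already forces the \<open>i\<close>-th component \<open>w\<close> of a solution in the
  cone to vanish, whatever the other component is. All three cases of the theorem follow at once,
  because each of them imposes one of the two conditions on every \<open>i\<close>. Write \<open>h s\<close> for the value of
  the nonlinearity along the solution, so that \<open>w t\<close> is the integral of \<open>k t s * g s * h s\<close>.

  \<^item> If \<open>h < m \<bar>w\<bar>\<close> wherever \<open>w \<noteq> 0\<close>, evaluate the equation at a point \<open>t\<close> where \<open>\<bar>w\<bar>\<close>
    attains its maximum \<open>N\<close>. Suppose \<open>N > 0\<close>. Then \<open>h < m N\<close> almost everywhere: where \<open>w\<close>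
    vanishes, so does \<open>h\<close>, by continuity of the nonlinearity in the state variables. Hence
    \<open>N \<le> \<integral>\<^sub>0\<^sup>1 \<bar>k t s\<bar> g s h s ds \<le> m N \<integral>\<^sub>0\<^sup>1 \<bar>k t s\<bar> g s ds \<le> N\<close>, and equality in the middle is
    possible only if \<open>\<bar>k t s\<bar> g s\<close> vanishes for almost every \<open>s\<close>. But then \<open>w t = 0\<close>, a
    contradiction (lemma \<open>sublinear_solution_zero\<close>).
  \<^item> If \<open>h > M w\<close> where \<open>w > 0\<close> on \<open>{a..b}\<close>, and \<open>w\<close> is not zero, then the cone condition makes
    \<open>w\<close> positive on \<open>{a..b}\<close>. At a point \<open>t\<close> where \<open>w\<close> attains its minimum \<open>p\<close> over that
    interval, \<open>p = w t \<ge> \<integral>\<^sub>a\<^sup>b k t s g s h s ds > M p \<integral>\<^sub>a\<^sup>b k t s g s ds \<ge> p\<close>, a contradiction. The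
    middle inequality is strict because \<open>k t s g s\<close> has positive integral over \<open>{a..b}\<close>
    (lemma \<open>superlinear_solution_zero\<close>).

  Both arguments compare integrals of \<open>k t s * g s\<close> for one fixed \<open>t\<close>, so they need this function
  of \<open>s\<close> to be measurable. Joint measurability of \<open>k\<close> yields that only for almost every \<open>t\<close>;
  continuity of \<open>k\<close> in its first variable extends it to every \<open>t\<close>
  (lemma \<open>kernel_section_measurable\<close>). Integrability of \<open>k t s * g s * h s\<close> at the chosen \<open>t\<close>
  comes from the solution itself: the integral of a non-integrable function is 0 by convention,
  whereas \<open>w t \<noteq> 0\<close>.
\<close>

section \<open>Measurability of kernel sections\<close>

text \<open>Sections of Borel functions are Borel, and a Lebesgue measurable function differs from a
  Borel function only on a null set, almost every section of which is null. An exceptional null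
  set of \<open>t\<close> cannot be avoided: a non-measurable set placed on a single vertical line is a null
  set of the plane.\<close>

lemma AE_section_lebesgue_measurable:
  fixes f :: "real \<times> real \<Rightarrow> real"
  assumes "f \<in> borel_measurable lebesgue"
  shows "AE t in lebesgue. (\<lambda>s. f (t, s)) \<in> borel_measurable lebesgue"
proof -
  obtain f' where f': "f' \<in> borel_measurable lborel" and eq: "AE z in lborel. f z = f' z"
    using completion_ex_borel_measurable_real[OF assms] by blast
  have "AE z in (lborel \<Otimes>\<^sub>M lborel :: (real \<times> real) measure). f z = f' z"
    using eq unfolding lborel_prod .
  then have "AE t in lborel. AE s in lborel. f (t, s) = f' (t, s)"
    by (rule lborel_pair.AE_pair)
  then have "AE t in lborel. (\<lambda>s. f (t, s)) \<in> borel_measurable lebesgue"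
  proof eventually_elim
    case (elim t)
    have "(\<lambda>s. f' (t, s)) \<in> borel_measurable lebesgue"
      using f' by (intro measurable_completion) (simp add: borel_prod [symmetric])
    moreover have "AE s in lebesgue. f' (t, s) = f (t, s)"
      using AE_completion[OF elim] by (rule AE_mp) simp
    ultimately show ?case by (rule borel_measurable_AE)
  qed
  then show ?thesis by (rule AE_completion)
qed

text \<open>The sections at almost every \<open>t\<close> are measurable, and almost every point is enough to
  approach \<open>\<tau>\<close>: the section at \<open>\<tau>\<close> is the almost everywhere limit of measurable sections at
  points \<open>t \<longlonglongrightarrow> \<tau>\<close>.\<close>

lemma kernel_section_measurable:
  assumes "kernel_regular k" and \<tau>: "\<tau> \<in> {0..1}"
  shows "k \<tau> \<in> borel_measurable I01"
proof -
  let ?Q = "{0..1} \<times> {0..1} :: (real \<times> real) set"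
  have "closed ?Q" by (intro closed_Times closed_atLeastAtMost)
  then have "?Q \<in> sets lebesgue" by (simp add: borel_closed)
  with assms have "(\<lambda>z. if z \<in> ?Q then (\<lambda>(t, s). k t s) z else 0) \<in> borel_measurable lebesgue"
    unfolding kernel_regular_def by (intro borel_measurable_if_I) auto
  note sections = AE_section_lebesgue_measurable[OF this]
  define good where "good t \<longleftrightarrow> k t \<in> borel_measurable I01" for t
  have "AE t in lebesgue. t \<in> {0..1} \<longrightarrow> good t"
    using sections
  proof eventually_elim
    case (elim t)
    show ?case
    proof
      assume "t \<in> {0..1}"
      then have "(\<lambda>s. if s \<in> {0..1} then k t s else 0) \<in> borel_measurable lebesgue"
        using elim by (simp cong: if_cong)
      then show "good t" unfolding good_def by (rule borel_measurable_if_D)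
    qed
  qed
  then have negl: "negligible {t. \<not> (t \<in> {0..1} \<longrightarrow> good t)}"
    by (simp add: negligible_iff_null_sets AE_iff_null_sets eventually_ae_filter)
       (metis (no_types, lifting) completion.complete2)
  have "\<exists>t\<in>{0..1}. t \<noteq> \<tau> \<and> \<bar>t - \<tau>\<bar> < inverse (real (Suc n)) \<and> good t" for n
  proof -
    define e where "e = inverse (real (Suc n))"
    have "e > 0" by (simp add: e_def)
    define S where "S = {max 0 (\<tau> - e)<..<min 1 (\<tau> + e)}"
    have "max 0 (\<tau> - e) < min 1 (\<tau> + e)"
      using \<tau> \<open>e > 0\<close> by simp
    then have "\<not> negligible S"
      unfolding S_def by (intro open_not_negligible) auto
    moreover have "negligible (insert \<tau> {t. \<not> (t \<in> {0..1} \<longrightarrow> good t)})"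
      using negl by simp
    ultimately have "\<not> S \<subseteq> insert \<tau> {t. \<not> (t \<in> {0..1} \<longrightarrow> good t)}"
      using negligible_subset by blast
    moreover have "S \<subseteq> {0..1}" by (auto simp: S_def)
    ultimately obtain t where "t \<in> S" "t \<noteq> \<tau>" "t \<in> {0..1}" "good t" by blast
    then have "\<bar>t - \<tau>\<bar> < e" by (auto simp: S_def abs_less_iff)
    then show ?thesis
      using \<open>t \<noteq> \<tau>\<close> \<open>t \<in> {0..1}\<close> \<open>good t\<close> unfolding e_def by blast
  qed
  then obtain x where x: "\<And>n. x n \<in> {0..1}" "\<And>n. x n \<noteq> \<tau>"
      "\<And>n. \<bar>x n - \<tau>\<bar> < inverse (real (Suc n))" "\<And>n. good (x n)"
    by metis
  have "(\<lambda>n. x n - \<tau>) \<longlonglongrightarrow> 0"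
  proof (rule Lim_null_comparison[OF _ LIMSEQ_inverse_real_of_nat])
    show "\<forall>\<^sub>F n in sequentially. norm (x n - \<tau>) \<le> inverse (real (Suc n))"
      using x(3) by (simp add: less_imp_le del: of_nat_Suc)
  qed
  then have "x \<longlonglongrightarrow> \<tau>" by (simp add: LIM_zero_iff)
  then have lim_x: "filterlim x (at \<tau> within {0..1}) sequentially"
    using x(1,2) by (simp add: filterlim_at)
  have "AE s in I01. lim (\<lambda>n. k (x n) s) = k \<tau> s"
  proof -
    have "AE s in I01. ((\<lambda>t. \<bar>k t s - k \<tau> s\<bar>) \<longlongrightarrow> 0) (at \<tau> within {0..1})"
      using assms unfolding kernel_regular_def by blast
    then show ?thesis
    proof eventually_elim
      case (elim s)
      then have "(\<lambda>n. \<bar>k (x n) s - k \<tau> s\<bar>) \<longlonglongrightarrow> 0"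
        using lim_x by (rule filterlim_compose)
      then have "(\<lambda>n. k (x n) s) \<longlonglongrightarrow> k \<tau> s"
        by (simp add: tendsto_rabs_zero_iff LIM_zero_iff)
      then show ?case by (rule limI)
    qed
  qed
  then have ae: "AE s in lebesgue. (if s \<in> {0..1} then lim (\<lambda>n. k (x n) s) else 0)
      = (if s \<in> {0..1} then k \<tau> s else 0)"
    by (subst (asm) AE_restrict_space_iff) auto
  have "(\<lambda>s. lim (\<lambda>n. k (x n) s)) \<in> borel_measurable I01"
    using x(4) by (intro borel_measurable_lim_metric) (simp add: good_def)
  then have "(\<lambda>s. if s \<in> {0..1} then lim (\<lambda>n. k (x n) s) else 0) \<in> borel_measurable lebesgue"
    by (rule borel_measurable_if_I) auto
  from borel_measurable_AE[OF this ae] show ?thesis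
    by (rule borel_measurable_if_D)
qed

lemma kernel_weight_integrable:
  assumes "kernel_regular k" "kernel_bounds k a b \<Phi> c" "weight g \<Phi> a b" "t \<in> {0..1}"
  shows "integrable I01 (\<lambda>s. k t s * g s)"
proof (rule Bochner_Integration.integrable_bound)
  show "integrable I01 (\<lambda>s. g s * \<Phi> s)"
    using assms unfolding weight_def by blast
  show "(\<lambda>s. k t s * g s) \<in> borel_measurable I01"
    using kernel_section_measurable[OF assms(1,4)] assms(3) unfolding weight_def
    by (intro borel_measurable_times borel_measurable_abs) auto
  have "AE s in I01. \<bar>k t s\<bar> \<le> \<Phi> s" "AE s in I01. 0 \<le> g s"
    using assms unfolding kernel_bounds_def weight_def by auto
  then show "AE s in I01. norm (k t s * g s) \<le> norm (g s * \<Phi> s)"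
  proof eventually_elim
    case (elim s)
    then have "\<bar>k t s\<bar> * g s \<le> \<Phi> s * g s" by (rule mult_right_mono)
    with elim show ?case by (simp add: abs_mult mult.commute)
  qed
qed

lemma integrable_abs_kernel_weight:
  assumes "kernel_regular k" "kernel_bounds k a b \<Phi> c" "weight g \<Phi> a b" "t \<in> {0..1}"
  shows "integrable I01 (\<lambda>s. \<bar>k t s\<bar> * g s)"
proof (rule Bochner_Integration.integrable_bound[OF kernel_weight_integrable[OF assms]])
  show "(\<lambda>s. \<bar>k t s\<bar> * g s) \<in> borel_measurable I01"
    using kernel_section_measurable[OF assms(1,4)] assms(3) unfolding weight_def
    by (intro borel_measurable_times borel_measurable_abs) auto
qed (simp add: abs_mult)

section \<open>The supremum norm\<close>

lemma
  assumes "continuous_on {0..1} w"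
  shows abs_le_sup_norm: "t \<in> {0..1} \<Longrightarrow> \<bar>w t\<bar> \<le> sup_norm w"
    and sup_norm_attained: "\<exists>t\<in>{0..1}. \<bar>w t\<bar> = sup_norm w"
proof -
  have cont: "continuous_on {0..1} (\<lambda>t. \<bar>w t\<bar>)"
    using assms by (intro continuous_intros)
  have bdd: "bdd_above ((\<lambda>t. \<bar>w t\<bar>) ` {0..1})"
    by (intro bounded_imp_bdd_above compact_imp_bounded compact_continuous_image cont) auto
  show le: "\<bar>w t\<bar> \<le> sup_norm w" if "t \<in> {0..1}" for t
    unfolding sup_norm_def using bdd that by (intro cSUP_upper)
  obtain t where t: "t \<in> {0..1}" "\<And>s. s \<in> {0..1} \<Longrightarrow> \<bar>w s\<bar> \<le> \<bar>w t\<bar>"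
    using continuous_attains_sup[of "{0..1::real}", OF _ _ cont] by auto
  then have "sup_norm w \<le> \<bar>w t\<bar>"
    unfolding sup_norm_def by (intro cSUP_least) auto
  with t le show "\<exists>t\<in>{0..1}. \<bar>w t\<bar> = sup_norm w" by force
qed

section \<open>Growth below the upper threshold\<close>

text \<open>The value of \<open>h\<close> where \<open>w = 0\<close> has to be prescribed: the growth bound leaves it free, and
  the strict bound of \<open>h\<close> by \<open>m N\<close> must hold almost everywhere. Positivity of \<open>m\<close> both gives
  this bound where \<open>w = 0\<close> and makes \<open>1 / m\<close> the supremum in the definition of \<open>m\<close>.\<close>

lemma sublinear_solution_zero:
  assumes kernel: "kernel_regular k" "kernel_bounds k a b \<Phi> c" and g: "weight g \<Phi> a b"
    and cont: "continuous_on {0..1} w"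
    and h_nonneg: "\<And>s. s \<in> {0..1} \<Longrightarrow> 0 \<le> h s"
    and h_zero: "AE s in I01. w s = 0 \<longrightarrow> h s = 0"
    and h_less: "\<And>s. s \<in> {0..1} \<Longrightarrow> w s \<noteq> 0 \<Longrightarrow> h s < m_const k g * \<bar>w s\<bar>"
    and m_pos: "0 < m_const k g"
    and eq: "\<And>t. t \<in> {0..1} \<Longrightarrow> w t = (LINT s|I01. k t s * g s * h s)"
  shows "sup_norm w = 0"
proof (rule ccontr)
  assume nz: "sup_norm w \<noteq> 0"
  let ?m = "m_const k g" and ?N = "sup_norm w"
  obtain t where t: "t \<in> {0..1}" and max: "\<bar>w t\<bar> = ?N"
    using sup_norm_attained[OF cont] by blast
  with nz have N: "0 < ?N" by linarith
  note int_kg = integrable_abs_kernel_weight[OF kernel g]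
  have g_nonneg: "AE s in I01. 0 \<le> g s" using g unfolding weight_def by blast
  have int_f: "integrable I01 (\<lambda>s. k t s * g s * h s)"
    using not_integrable_integral_eq eq[OF t] max N by fastforce
  have h_less_N: "AE s in I01. 0 \<le> h s \<and> h s < ?m * ?N"
  proof -
    have "AE s in I01. s \<in> space I01" by (rule AE_space)
    with h_zero show ?thesis
    proof eventually_elim
      case (elim s)
      then have s: "s \<in> {0..1}" by simp
      have "?m * \<bar>w s\<bar> \<le> ?m * ?N"
        using abs_le_sup_norm[OF cont s] m_pos by (intro mult_left_mono) auto
      moreover have "h s < ?m * ?N" if "w s = 0"
        using elim that m_pos N by simp
      ultimately show ?case
        using h_less[OF s] h_nonneg[OF s] by fastforce
    qed
  qed
  have bdd: "bdd_above ((\<lambda>t. LINT s|I01. \<bar>k t s\<bar> * g s) ` {0..1})"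
  proof (rule bdd_aboveI2)
    fix t :: real assume t: "t \<in> {0..1}"
    have "AE s in I01. \<bar>k t s\<bar> \<le> \<Phi> s" using kernel(2) t unfolding kernel_bounds_def by blast
    then show "(LINT s|I01. \<bar>k t s\<bar> * g s) \<le> (LINT s|I01. g s * \<Phi> s)"
      using g_nonneg g kernel unfolding weight_def
    proof (intro integral_mono_AE int_kg[OF t])
      assume "AE s in I01. \<bar>k t s\<bar> \<le> \<Phi> s" "AE s in I01. 0 \<le> g s"
      then show "AE s in I01. \<bar>k t s\<bar> * g s \<le> g s * \<Phi> s"
      proof eventually_elim
        case (elim s)
        then have "\<bar>k t s\<bar> * g s \<le> \<Phi> s * g s" by (rule mult_right_mono)
        then show ?case by (simp add: mult.commute)
      qed
    qed auto
  qed
  have kg_le: "(LINT s|I01. \<bar>k t s\<bar> * g s) \<le> 1 / ?m"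
    using cSUP_upper[OF t bdd] unfolding m_const_def by simp
  let ?J = "LINT s|I01. \<bar>k t s * g s * h s\<bar>" and ?kg = "LINT s|I01. \<bar>k t s\<bar> * g s"
  \<comment> \<open>The integral of the nonnegative function
    \<open>d s = \<bar>k t s\<bar> g s (m N - h s)\<close> is at most \<open>N - \<bar>w t\<bar> = 0\<close>.\<close>
  have "\<bar>w t\<bar> \<le> ?J" using eq[OF t] integral_abs_bound[of I01] by simp
  moreover have "?m * ?N * ?kg \<le> ?N"
    using kg_le m_pos N by (simp add: field_simps)
  ultimately have "?m * ?N * ?kg - ?J \<le> 0" using max by linarith
  moreover have int_d: "integrable I01 (\<lambda>s. ?m * ?N * (\<bar>k t s\<bar> * g s) - \<bar>k t s * g s * h s\<bar>)"
    using int_kg[OF t] int_f by (intro Bochner_Integration.integrable_diff integrable_mult_right integrable_abs) auto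
  moreover have "(LINT s|I01. ?m * ?N * (\<bar>k t s\<bar> * g s) - \<bar>k t s * g s * h s\<bar>) = ?m * ?N * ?kg - ?J"
    using int_kg[OF t] int_f by simp
  moreover have d_nonneg: "AE s in I01. 0 \<le> ?m * ?N * (\<bar>k t s\<bar> * g s) - \<bar>k t s * g s * h s\<bar>"
    using h_less_N g_nonneg
  proof eventually_elim
    case (elim s)
    then have "\<bar>k t s\<bar> * g s * h s \<le> \<bar>k t s\<bar> * g s * (?m * ?N)"
      by (intro mult_left_mono) auto
    with elim show ?case by (simp add: abs_mult algebra_simps)
  qed
  ultimately have "AE s in I01. ?m * ?N * (\<bar>k t s\<bar> * g s) - \<bar>k t s * g s * h s\<bar> = 0"
    using integral_nonneg_eq_0_iff_AE[OF int_d d_nonneg] integral_nonneg_AE[OF d_nonneg] by linarith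
  then have "AE s in I01. k t s * g s * h s = 0"
    using h_less_N g_nonneg
  proof eventually_elim
    case (elim s)
    then have "\<bar>k t s\<bar> * g s * (?m * ?N - h s) = 0"
      by (simp add: abs_mult algebra_simps)
    with elim show ?case by auto
  qed
  then have "w t = 0"
    unfolding eq[OF t] by (rule integral_eq_zero_AE)
  with max N show False by simp
qed

section \<open>Growth above the lower threshold\<close>

text \<open>The cone condition makes \<open>w\<close> strictly positive on \<open>{a..b}\<close>, which brings the growth bound
  into play. The lower bound of \<open>k\<close> by \<open>c * \<Phi>\<close> has two effects at points \<open>t\<close> of \<open>{a..b}\<close>: the
  integrand is nonnegative on all of \<open>{0..1}\<close>, so that cutting the integral down to \<open>{a..b}\<close>
  decreases it, and, the integral of \<open>\<Phi> * g\<close> being positive, \<open>1 / M\<close> is a positive infimum.\<close>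

lemma superlinear_solution_zero:
  assumes kernel: "kernel_regular k" "kernel_bounds k a b \<Phi> c" and g: "weight g \<Phi> a b"
    and cone: "w \<in> cone_tilde a b c"
    and h_nonneg: "\<And>s. s \<in> {0..1} \<Longrightarrow> 0 \<le> h s"
    and h_greater: "\<And>s. s \<in> {a..b} \<Longrightarrow> 0 < w s \<Longrightarrow> M_const k g a b * w s < h s"
    and eq: "\<And>t. t \<in> {0..1} \<Longrightarrow> w t = (LINT s|I01. k t s * g s * h s)"
  shows "sup_norm w = 0"
proof (rule ccontr)
  assume nz: "sup_norm w \<noteq> 0"
  let ?M = "M_const k g a b" and ?N = "sup_norm w"
  have ab: "0 \<le> a" "a \<le> b" "b \<le> 1" and c: "0 < c"
    using kernel(2) unfolding kernel_bounds_def by auto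
  then have sub: "t \<in> {0..1}" if "t \<in> {a..b}" for t using that by auto
  have cont: "continuous_on {0..1} w" and INF: "c * ?N \<le> (INF t\<in>{a..b}. w t)"
    using cone unfolding cone_tilde_def by auto
  have cont_ab: "continuous_on {a..b} w"
    using cont by (rule continuous_on_subset) (use sub in auto)
  have bdd_w: "bdd_below (w ` {a..b})"
    by (intro bounded_imp_bdd_below compact_imp_bounded compact_continuous_image cont_ab) auto
  have "0 \<le> ?N" using abs_le_sup_norm[OF cont, of 0] by simp
  with nz c have cN: "0 < c * ?N" by simp
  have w_pos: "0 < w s" if "s \<in> {a..b}" for s
    using cINF_lower[OF bdd_w that] INF cN by linarith
  obtain t where t: "t \<in> {a..b}" and min: "\<And>s. s \<in> {a..b} \<Longrightarrow> w t \<le> w s"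
    using continuous_attains_inf[of "{a..b}", OF _ _ cont_ab] ab by auto
  have restrict: "lebesgue_on {a..b} = restrict_space I01 {a..b}"
    using ab by (simp add: restrict_restrict_space Int_absorb1)
  have meas: "{a..b} \<inter> space I01 \<in> sets I01"
    using ab by (simp add: sets_restrict_space_iff Int_absorb2)
  have AE_ab: "AE s in lebesgue_on {a..b}. P s" if "AE s in I01. P s" for P
    unfolding restrict AE_restrict_space_iff[OF meas] using that by eventually_elim simp
  have int_ab: "integrable (lebesgue_on {a..b}) F" if "integrable I01 F" for F :: "real \<Rightarrow> real"
    unfolding restrict integrable_restrict_space[OF meas]
    using meas ab that by (intro integrable_mult_indicator) (auto simp: Int_absorb2)
  have g_nonneg: "AE s in I01. 0 \<le> g s" using g unfolding weight_def by blast
  have \<Phi>_nonneg: "AE s in I01. 0 \<le> \<Phi> s"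
  proof -
    have "AE s in I01. \<bar>k t s\<bar> \<le> \<Phi> s"
      using kernel(2) sub[OF t] unfolding kernel_bounds_def by blast
    then show ?thesis by eventually_elim linarith
  qed
  have k_ge: "AE s in I01. c * \<Phi> s \<le> k r s" if "r \<in> {a..b}" for r
    using kernel(2) that unfolding kernel_bounds_def by blast
  have kg_nonneg: "AE s in I01. 0 \<le> k r s * g s" if "r \<in> {a..b}" for r
    using k_ge[OF that] \<Phi>_nonneg g_nonneg
  proof eventually_elim
    case (elim s)
    then have "0 \<le> c * \<Phi> s" using c by simp
    with elim show ?case by simp
  qed
  have int_kg: "integrable (lebesgue_on {a..b}) (\<lambda>s. k r s * g s)" if "r \<in> {a..b}" for r
    using int_ab[OF kernel_weight_integrable[OF kernel g sub[OF that]]] .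
  let ?A = "LINT s|lebesgue_on {a..b}. \<Phi> s * g s"
    and ?kg = "\<lambda>r. LINT s|lebesgue_on {a..b}. k r s * g s"
  have A_pos: "0 < ?A" using g unfolding weight_def by blast
  have kg_ge: "c * ?A \<le> ?kg r" if "r \<in> {a..b}" for r
  proof -
    have "integrable (lebesgue_on {a..b}) (\<lambda>s. c * (\<Phi> s * g s))"
      using g unfolding weight_def by (intro integrable_mult_right int_ab) (simp add: mult.commute)
    moreover have "AE s in lebesgue_on {a..b}. c * (\<Phi> s * g s) \<le> k r s * g s"
      using AE_ab[OF k_ge[OF that]] AE_ab[OF g_nonneg]
      by eventually_elim (simp add: mult_right_mono flip: mult.assoc)
    ultimately have "(LINT s|lebesgue_on {a..b}. c * (\<Phi> s * g s)) \<le> ?kg r"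
      using int_kg[OF that] by (intro integral_mono_AE)
    then show ?thesis by simp
  qed
  define L where "L = (INF r\<in>{a..b}. ?kg r)"
  have M: "?M = 1 / L" by (simp add: M_const_def L_def)
  have L_pos: "0 < L"
  proof -
    have "c * ?A \<le> L" unfolding L_def using ab kg_ge by (intro cINF_greatest) auto
    then show ?thesis using c A_pos mult_pos_pos[of c ?A] by linarith
  qed
  have L_le: "L \<le> ?kg t"
    unfolding L_def using t kg_ge by (intro cINF_lower bdd_belowI2[of _ "c * ?A"]) auto
  have int_f: "integrable I01 (\<lambda>s. k t s * g s * h s)"
    using not_integrable_integral_eq eq[OF sub[OF t]] w_pos[OF t] by fastforce
  have f_ge: "(LINT s|lebesgue_on {a..b}. k t s * g s * h s) \<le> w t"
  proof -
    have "AE s in I01. s \<in> space I01" by (rule AE_space)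
    with kg_nonneg[OF t]
    have "AE s in I01. indicator {a..b} s *\<^sub>R (k t s * g s * h s) \<le> k t s * g s * h s"
    proof eventually_elim
      case (elim s)
      then have "0 \<le> k t s * g s * h s" using h_nonneg[of s] by (intro mult_nonneg_nonneg[of _ "h s"]) auto
      then show ?case by (simp add: indicator_def)
    qed
    then have "(LINT s|I01. indicator {a..b} s *\<^sub>R (k t s * g s * h s)) \<le> w t"
      unfolding eq[OF sub[OF t]] using int_f meas ab
      by (intro integral_mono_AE integrable_mult_indicator) (auto simp: Int_absorb2)
    then show ?thesis
      unfolding restrict integral_restrict_space[OF meas] .
  qed
  have h_greater_p: "?M * w t < h s" if "s \<in> {a..b}" for s
    using h_greater[OF that w_pos[OF that]] mult_left_mono[OF min[OF that], of ?M] L_pos M by simp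
  \<comment> \<open>With \<open>p = w t\<close>, the nonnegative function \<open>d s = k t s g s (h s - M p)\<close> has integral at
    most \<open>p - p = 0\<close> over \<open>{a..b}\<close>.\<close>
  let ?d = "\<lambda>s. k t s * g s * h s - ?M * w t * (k t s * g s)"
  have int_d: "integrable (lebesgue_on {a..b}) ?d"
    using int_kg[OF t] int_ab[OF int_f]
    by (intro Bochner_Integration.integrable_diff integrable_mult_right)
  have "w t \<le> ?M * w t * ?kg t"
    using L_le L_pos w_pos[OF t] unfolding M by (simp add: field_simps)
  then have d_le: "(LINT s|lebesgue_on {a..b}. ?d s) \<le> 0"
    using f_ge int_kg[OF t] int_ab[OF int_f] by simp
  have AE_in: "AE s in lebesgue_on {a..b}. s \<in> space (lebesgue_on {a..b})"
    by (rule AE_space)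
  have d_nonneg: "AE s in lebesgue_on {a..b}. 0 \<le> ?d s"
    using AE_ab[OF kg_nonneg[OF t]] AE_in
  proof eventually_elim
    case (elim s)
    then have "k t s * g s * (?M * w t) \<le> k t s * g s * h s"
      using h_greater_p[of s] by (intro mult_left_mono) auto
    then show ?case by (simp add: algebra_simps)
  qed
  have "AE s in lebesgue_on {a..b}. ?d s = 0"
    using integral_nonneg_eq_0_iff_AE[OF int_d d_nonneg] integral_nonneg_AE[OF d_nonneg] d_le
    by linarith
  then have "AE s in lebesgue_on {a..b}. k t s * g s = 0"
    using AE_in
  proof eventually_elim
    case (elim s)
    then have "k t s * g s * (h s - ?M * w t) = 0" by (simp add: algebra_simps)
    with h_greater_p[of s] elim show ?case by auto
  qed
  then have "?kg t = 0" by (rule integral_eq_zero_AE)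
  with L_le L_pos show False by linarith
qed

section \<open>The system\<close>

text \<open>The growth bound says nothing on the hyperplane \<open>x $ i = 0\<close> itself. There \<open>F\<close> is squeezed
  to 0 by approaching the hyperplane along the \<open>i\<close>-th axis.\<close>

lemma vanishes_on_hyperplane:
  fixes F :: "real ^ 'n \<Rightarrow> real"
  assumes cont: "continuous_on UNIV F" and nonneg: "\<And>x. 0 \<le> F x"
    and less: "\<And>x. x $ i \<noteq> 0 \<Longrightarrow> F x < m * \<bar>x $ i\<bar>" and y: "y $ i = 0"
  shows "F y = 0"
proof -
  have "continuous_on UNIV (\<lambda>e::real. F (y + e *\<^sub>R axis i 1))"
    by (intro continuous_on_compose2[OF cont] continuous_intros) auto
  then have "((\<lambda>e. F (y + e *\<^sub>R axis i 1)) \<longlongrightarrow> F (y + 0 *\<^sub>R axis i 1)) (at 0)"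
    by (simp only: continuous_on_def) (metis UNIV_I)
  then have lim_F: "((\<lambda>e. F (y + e *\<^sub>R axis i 1)) \<longlongrightarrow> F y) (at 0)" by simp
  have lim_m: "((\<lambda>e::real. m * \<bar>e\<bar>) \<longlongrightarrow> 0) (at 0)"
    by (auto intro!: tendsto_eq_intros)
  have le: "\<forall>\<^sub>F e in at 0. F (y + e *\<^sub>R axis i 1) \<le> m * \<bar>e\<bar>"
    unfolding eventually_at
  proof (intro exI conjI ballI impI)
    fix e :: real assume "e \<noteq> 0 \<and> dist e 0 < 1"
    then show "F (y + e *\<^sub>R axis i 1) \<le> m * \<bar>e\<bar>"
      using less[of "y + e *\<^sub>R axis i 1"] y by simp
  qed simp
  have "F y \<le> 0" using lim_m lim_F le by (intro tendsto_le) auto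
  with nonneg[of y] show ?thesis by linarith
qed

text \<open>The decoupling: the path \<open>x\<close> has to satisfy the equation and the cone condition only in its
  \<open>i\<close>-th coordinate. The other coordinate enters through \<open>f s (x s)\<close> alone, and the growth
  conditions bound this uniformly in it.\<close>

lemma growth_condition_forces_zero:
  fixes x :: "real \<Rightarrow> real ^ 2"
  assumes f: "nonlinearity f"
    and kernel: "kernel_regular k" "kernel_bounds k a b \<Phi> c" and g: "weight g \<Phi> a b"
    and cone: "(\<lambda>s. x s $ i) \<in> cone_tilde a b c"
    and eq: "\<And>t. t \<in> {0..1} \<Longrightarrow> x t $ i = (LINT s|I01. k t s * g s * f s (x s))"
    and growth: "(\<forall>t\<in>{0..1}. \<forall>y. y $ i \<noteq> 0 \<longrightarrow> f t y < m_const k g * \<bar>y $ i\<bar>) \<or>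
      (\<forall>t\<in>{a..b}. \<forall>y. y $ i > 0 \<longrightarrow> f t y > M_const k g a b * y $ i)"
  shows "sup_norm (\<lambda>s. x s $ i) = 0"
proof -
  have f_nonneg: "0 \<le> f t y" if "t \<in> {0..1}" for t y
    using f that unfolding nonlinearity_def by blast
  from growth show ?thesis
  proof
    assume less: "\<forall>t\<in>{0..1}. \<forall>y. y $ i \<noteq> 0 \<longrightarrow> f t y < m_const k g * \<bar>y $ i\<bar>"
    have "f 0 (axis i 1) < m_const k g * \<bar>axis i 1 $ i\<bar>"
      using less[rule_format, of 0 "axis i 1"] by simp
    then have m_pos: "0 < m_const k g"
      using f_nonneg[of 0 "axis i 1"] by simp
    have "AE s in I01. s \<in> space I01" by (rule AE_space)
    moreover have "AE s in I01. continuous_on UNIV (f s)"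
      using f unfolding nonlinearity_def caratheodory_def by blast
    ultimately have "AE s in I01. x s $ i = 0 \<longrightarrow> f s (x s) = 0"
    proof eventually_elim
      case (elim s)
      then have "s \<in> {0..1}" by simp
      with elim less f_nonneg show ?case
        by (blast intro: vanishes_on_hyperplane)
    qed
    then show ?thesis
      using cone less
      by (intro sublinear_solution_zero[OF kernel g _ f_nonneg _ _ m_pos eq])
        (auto simp: cone_tilde_def)
  next
    assume "\<forall>t\<in>{a..b}. \<forall>y. y $ i > 0 \<longrightarrow> f t y > M_const k g a b * y $ i"
    then show ?thesis
      by (intro superlinear_solution_zero[OF kernel g cone f_nonneg _ eq]) auto
  qed
qed

theorem theorem4p1:
  fixes f :: "2 \<Rightarrow> real \<Rightarrow> real ^ 2 \<Rightarrow> real"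
    and k :: "2 \<Rightarrow> real \<Rightarrow> real \<Rightarrow> real"
    and g \<Phi> :: "2 \<Rightarrow> real \<Rightarrow> real"
    and a b c :: "2 \<Rightarrow> real"
  assumes f: "\<And>i. nonlinearity (f i)"
    and k_regular: "\<And>i. kernel_regular (k i)"
    and k_bounds: "\<And>i. kernel_bounds (k i) (a i) (b i) (\<Phi> i) (c i)"
    and g: "\<And>i. weight (g i) (\<Phi> i) (a i) (b i)"
    and cases:
      "(\<forall>i. \<forall>t\<in>{0..1}. \<forall>x. x $ i \<noteq> 0 \<longrightarrow> f i t x < m_const (k i) (g i) * \<bar>x $ i\<bar>)
       \<or> (\<forall>i. \<forall>t\<in>{a i..b i}. \<forall>x. x $ i > 0 \<longrightarrow>
            f i t x > M_const (k i) (g i) (a i) (b i) * x $ i)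
       \<or> (\<exists>i.
            (\<forall>t\<in>{0..1}. \<forall>x. x $ i \<noteq> 0 \<longrightarrow> f i t x < m_const (k i) (g i) * \<bar>x $ i\<bar>) \<and>
            (\<forall>j. j \<noteq> i \<longrightarrow> (\<forall>t\<in>{a j..b j}. \<forall>x. x $ j > 0 \<longrightarrow>
              f j t x > M_const (k j) (g j) (a j) (b j) * x $ j)))"
  shows "\<not> (\<exists>u v. nontrivial_solution k g f a b c (u, v))"
proof
  assume "\<exists>u v. nontrivial_solution k g f a b c (u, v)"
  then obtain u v where sol: "nontrivial_solution k g f a b c (u, v)" by blast
  define below where "below i \<longleftrightarrow>
    (\<forall>t\<in>{0..1}. \<forall>y. y $ i \<noteq> 0 \<longrightarrow> f i t y < m_const (k i) (g i) * \<bar>y $ i\<bar>)" for i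
  define above where "above i \<longleftrightarrow>
    (\<forall>t\<in>{a i..b i}. \<forall>y. y $ i > 0 \<longrightarrow> f i t y > M_const (k i) (g i) (a i) (b i) * y $ i)" for i
  define x :: "real \<Rightarrow> real ^ 2" where "x s = vector [u s, v s]" for s
  have x: "x s $ 1 = u s" "x s $ 2 = v s" for s by (simp_all add: x_def)
  have "\<forall>i. (\<lambda>s. x s $ i) \<in> cone_tilde (a i) (b i) (c i)"
    using sol unfolding nontrivial_solution_def cone_def forall_2 by (simp add: x)
  moreover have "\<forall>i. \<forall>t\<in>{0..1}. x t $ i = (LINT s|I01. k i t s * g i s * f i s (x s))"
    using sol unfolding nontrivial_solution_def solves_system_def forall_2
    by (simp add: x_def)
  moreover have "below i \<or> above i" for i
  proof -
    have "(\<forall>i. below i) \<or> (\<forall>i. above i) \<or> (\<exists>i. below i \<and> (\<forall>j. j \<noteq> i \<longrightarrow> above j))"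
      unfolding below_def above_def by (fact cases)
    then show ?thesis by metis
  qed
  ultimately have "sup_norm (\<lambda>s. x s $ i) = 0" for i
    unfolding below_def above_def
    by (intro growth_condition_forces_zero[OF f k_regular k_bounds g]) blast+
  from this[of 1] this[of 2] have "pair_norm (u, v) = 0"
    by (simp add: x pair_norm_def)
  with sol show False unfolding nontrivial_solution_def by blast
qed

end
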